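(* Let $\alpha_0,\alpha_1,\alpha_2,\alpha_3,\alpha_4$ be complex parameters with $\alpha_0+\alpha_1+2\alpha_2+2\alpha_3+\alpha_4=1$ and consider the Hamiltonian system $$\frac{dx}{dt}=\frac{\partial H}{\partial y},\quad \frac{dy}{dt}=-\frac{\partial H}{\partial x},\quad \frac{dz}{dt}=\frac{\partial H}{\partial w},\quad \frac{dw}{dt}=-\frac{\partial H}{\partial z}$$ with $$\begin{aligned} t(t-1)H =\;&x^2y^3-((t+1)x+2\alpha_2+\alpha_3+\alpha_4)xy^2\\ &+\{tx^2+(\alpha_0+2\alpha_2+\alpha_3+\alpha_4-(\alpha_0+\alpha_1)t)x+\alpha_2(\alpha_2+\alpha_3+\alpha_4)\}y+\alpha_1 t x\\ &+\tfrac{1}{4}\big[-z^2w^4+2\alpha_4 zw^3+((2t-1)z^2-\alpha_4^2)w^2\\ &\qquad-2\{-\alpha_0-2\alpha_2-\alpha_3-\alpha_4+(\alpha_4+1)t\}zw-t(t-1)z^2\big]\\ &+y((y-1)x-\alpha_2)zw. \end{aligned}$$ This system has the following invariant divisors: $f_0:=y-1$ when $\alpha_0=0$; $f_1:=y$ when $\alpha_1=0$; $f_2:=x$ when $\alpha_2=0$; $f_3:=y+w^2-t$ when $\alpha_3=0$; $f_4:=z$ when $\alpha_4=0$.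
   Context: A polynomial $f\in\mathbb{C}(t)[x,y,z,w]$ is an invariant divisor of the system (for given parameter values) if its derivative along the flow, $\frac{\partial f}{\partial t}+\frac{\partial H}{\partial y}\frac{\partial f}{\partial x}-\frac{\partial H}{\partial x}\frac{\partial f}{\partial y}+\frac{\partial H}{\partial w}\frac{\partial f}{\partial z}-\frac{\partial H}{\partial z}\frac{\partial f}{\partial w}$, is divisible by $f$ in $\mathbb{C}(t)[x,y,z,w]$; i.e. the hypersurface $f=0$ is invariant under the system. *)

theory Defs
  imports
    "HOL-Computational_Algebra.Computational_Algebra"
    "HOL-Computational_Algebra.Field_as_Ring"
    "HOL-Library.Poly_Mapping"
begin

type_synonym rat_fun = "complex poly fract"

datatype phase_var = X | Y | Z | W

text \<open>The polynomial ring $\mathbb{C}(t)[x,y,z,w]$: a monomial is an exponent vector on the four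
  phase variables, and a polynomial is a finitely supported map from monomials to
  $\mathbb{C}(t)$, multiplied by convolution.\<close>

type_synonym phase_poly = "(phase_var \<Rightarrow>\<^sub>0 nat) \<Rightarrow>\<^sub>0 rat_fun"

definition indet_t :: rat_fun
  where "indet_t = Fract [:0, 1:] 1"

definition coef :: "rat_fun \<Rightarrow> phase_poly"
  where "coef c = Poly_Mapping.single 0 c"

definition cnst :: "complex \<Rightarrow> phase_poly"
  where "cnst c = coef (Fract [:c:] 1)"

definition var :: "phase_var \<Rightarrow> phase_poly"
  where "var v = Poly_Mapping.single (Poly_Mapping.single v 1) 1"

definition deriv_rat_fun :: "rat_fun \<Rightarrow> rat_fun"
  where "deriv_rat_fun r =
    (let (p, q) = quot_of_fract r in Fract (pderiv p * q - p * pderiv q) (q * q))"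

lemma deriv_rat_fun_Fract:
  assumes "q \<noteq> 0"
  shows "deriv_rat_fun (Fract p q) = Fract (pderiv p * q - p * pderiv q) (q * q)"
proof -
  obtain r s where rs: "quot_of_fract (Fract p q) = (r, s)"
    by (cases "quot_of_fract (Fract p q)")
  have s: "s \<noteq> 0"
    using snd_quot_of_fract_nonzero[of "Fract p q"] rs by simp
  have "Fract r s = Fract p q"
    using quot_to_fract_quot_of_fract[of "Fract p q"] rs by (simp add: quot_to_fract_def)
  with assms s have eq: "p * s = r * q"
    by (simp add: eq_fract)
  then have "pderiv (p * s) = pderiv (r * q)"
    by simp
  then have "pderiv p * s + p * pderiv s = pderiv r * q + r * pderiv q"
    by (simp add: pderiv_mult algebra_simps)
  with eq have "(pderiv r * s - r * pderiv s) * (q * q) = (pderiv p * q - p * pderiv q) * (s * s)"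
    by algebra
  with assms s rs show ?thesis
    by (simp add: deriv_rat_fun_def eq_fract)
qed

definition partial_t :: "phase_poly \<Rightarrow> phase_poly"
  where "partial_t f = Poly_Mapping.map deriv_rat_fun f"

text \<open>The subtraction of exponent vectors is truncated, but a monomial in which \<open>v\<close> does not
  occur gets the coefficient 0.\<close>

definition partial :: "phase_var \<Rightarrow> phase_poly \<Rightarrow> phase_poly"
  where "partial v f = (\<Sum>m\<in>Poly_Mapping.keys f.
    Poly_Mapping.single (m - Poly_Mapping.single v 1)
      (of_nat (Poly_Mapping.lookup m v) * Poly_Mapping.lookup f m))"

definition flow_derivative :: "phase_poly \<Rightarrow> phase_poly \<Rightarrow> phase_poly"
  where "flow_derivative H f =
    partial_t f
      + partial Y H * partial X f - partial X H * partial Y f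
      + partial W H * partial Z f - partial Z H * partial W f"

definition invariant_divisor :: "phase_poly \<Rightarrow> phase_poly \<Rightarrow> bool"
  where "invariant_divisor H f \<longleftrightarrow> f dvd flow_derivative H f"

definition hamiltonian ::
    "complex \<Rightarrow> complex \<Rightarrow> complex \<Rightarrow> complex \<Rightarrow> complex \<Rightarrow> phase_poly"
  where "hamiltonian a0 a1 a2 a3 a4 =
    (let x = var X; y = var Y; z = var Z; w = var W; t = coef indet_t;
         \<alpha>0 = cnst a0; \<alpha>1 = cnst a1; \<alpha>2 = cnst a2; \<alpha>3 = cnst a3; \<alpha>4 = cnst a4
     in coef (1 / (indet_t * (indet_t - 1))) *
        (x^2 * y^3 - ((t + 1) * x + 2 * \<alpha>2 + \<alpha>3 + \<alpha>4) * x * y^2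
         + (t * x^2 + (\<alpha>0 + 2 * \<alpha>2 + \<alpha>3 + \<alpha>4 - (\<alpha>0 + \<alpha>1) * t) * x
              + \<alpha>2 * (\<alpha>2 + \<alpha>3 + \<alpha>4)) * y
         + \<alpha>1 * t * x
         + cnst (1 / 4) *
             (- (z^2 * w^4) + 2 * \<alpha>4 * z * w^3 + ((2 * t - 1) * z^2 - \<alpha>4^2) * w^2
              - 2 * (- \<alpha>0 - 2 * \<alpha>2 - \<alpha>3 - \<alpha>4 + (\<alpha>4 + 1) * t) * z * w
              - t * (t - 1) * z^2)
         + y * ((y - 1) * x - \<alpha>2) * z * w))"

end

theory Submission
  imports Defs
begin

text \<open>Each \<open>f\<^sub>i\<close> is monic of degree 1 in some phase variable, so the hypersurface is a graph
  and invariance can be read off by restricting the flow derivative to it. Write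
  \<open>K = t(t-1)H\<close>. For the four divisors \<open>y - 1\<close>, \<open>y\<close>, \<open>x\<close>, \<open>z\<close> the flow derivative is, up
  to sign, one partial derivative of \<open>H\<close>, and
    \<open>\<partial>K/\<partial>x = \<alpha>\<^sub>0(1 - t)\<close> on \<open>y = 1\<close>,
    \<open>\<partial>K/\<partial>x = \<alpha>\<^sub>1 t\<close> on \<open>y = 0\<close>,
    \<open>\<partial>K/\<partial>y = \<alpha>\<^sub>2(\<alpha>\<^sub>2 + \<alpha>\<^sub>3 + \<alpha>\<^sub>4 - zw)\<close> on \<open>x = 0\<close>,
    \<open>\<partial>K/\<partial>w = -\<alpha>\<^sub>4\<^sup>2 w/2\<close> on \<open>z = 0\<close>.
  So the remainder disappears with the parameter, and the quotient is an explicit polynomial.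

  The divisor \<open>f\<^sub>3 = y + w\<^sup>2 - t\<close> involves \<open>t\<close> and two variables; its flow derivative times
  \<open>t(t-1)\<close> is \<open>-t(t-1) - \<partial>K/\<partial>x - 2w \<partial>K/\<partial>z\<close>. Modulo \<open>w\<^sup>2 = t - y\<close> the terms with \<open>x\<close> and with
  \<open>zw\<close> cancel, and the normalisation
  \<open>\<alpha>\<^sub>0 + \<alpha>\<^sub>1 + 2\<alpha>\<^sub>2 + 2\<alpha>\<^sub>3 + \<alpha>\<^sub>4 = 1\<close> turns what remains into \<open>\<alpha>\<^sub>3(y\<^sup>2 - 2ty + t)\<close>. For
  \<open>\<alpha>\<^sub>3 = 0\<close> this gives \<open>y_plus_w2_minus_t_dvd\<close>, a divisibility valid in every commutative ring.

  The rest of the argument licenses these computations: \<open>partial\<close> and \<open>partial_t\<close>, which are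
  given coefficient by coefficient, obey the rules of calculus (\<open>partial_mult\<close>,
  \<open>deriv_rat_fun_diff\<close>), and \<open>cnst\<close> is a ring homomorphism, which carries the relation
  between the parameters into the polynomial ring.\<close>

section \<open>The partial derivatives as derivations\<close>

text \<open>Two polynomials have different sets of keys; a common finite superset as summation range
  makes additivity a matter of adding sums termwise.\<close>

lemma partial_eq_sum:
  assumes "finite A" and "Poly_Mapping.keys f \<subseteq> A"
  shows "partial v f = (\<Sum>m\<in>A. Poly_Mapping.single (m - Poly_Mapping.single v 1)
    (of_nat (Poly_Mapping.lookup m v) * Poly_Mapping.lookup f m))"
  unfolding partial_def
  by (rule sum.mono_neutral_left) (use assms in \<open>auto simp: in_keys_iff\<close>)

lemma partial_single:
  "partial v (Poly_Mapping.single m c) =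
    Poly_Mapping.single (m - Poly_Mapping.single v 1) (of_nat (Poly_Mapping.lookup m v) * c)"
  by (subst partial_eq_sum[of "{m}"]) auto

lemma partial_zero: "partial v 0 = 0"
  by (simp add: partial_def)

lemma partial_add: "partial v (f + g) = partial v f + partial v g"
proof -
  let ?A = "Poly_Mapping.keys f \<union> Poly_Mapping.keys g"
  have fin: "finite ?A" by simp
  have "Poly_Mapping.keys (f + g) \<subseteq> ?A" by (rule keys_add)
  then show ?thesis
    by (simp add: partial_eq_sum[OF fin] lookup_add distrib_left single_add sum.distrib)
qed

lemma partial_uminus: "partial v (- f) = - partial v f"
  using partial_add[of v f "- f"] by (simp add: partial_zero eq_neg_iff_add_eq_0 add.commute)

lemma partial_diff: "partial v (f - g) = partial v f - partial v g"
  using partial_add[of v f "- g"] by (simp add: partial_uminus)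

text \<open>Both products in the Leibniz rule carry the monomial \<open>m + n - e\<^sub>v\<close>. Truncated subtraction
  respects this when \<open>v\<close> occurs in the differentiated factor; otherwise the coefficient is 0.\<close>

lemma partial_single_mult_single:
  "partial v (Poly_Mapping.single m c * Poly_Mapping.single n d) =
    partial v (Poly_Mapping.single m c) * Poly_Mapping.single n d
    + Poly_Mapping.single m c * partial v (Poly_Mapping.single n d)"
proof -
  let ?e = "Poly_Mapping.single v 1 :: phase_var \<Rightarrow>\<^sub>0 nat"
  have shift: "(k + l) - ?e = (k - ?e) + l" if "Poly_Mapping.lookup k v \<noteq> 0"
    for k l :: "phase_var \<Rightarrow>\<^sub>0 nat"
    using that by (intro poly_mapping_eqI) (auto simp: lookup_add lookup_minus lookup_single when_def)
  have left: "Poly_Mapping.single ((m - ?e) + n) (of_nat (Poly_Mapping.lookup m v) * c * d) =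
      Poly_Mapping.single ((m + n) - ?e) (of_nat (Poly_Mapping.lookup m v) * c * d)"
  proof (cases "Poly_Mapping.lookup m v = 0")
    case False
    then show ?thesis by (simp only: shift not_False_eq_True)
  qed simp
  have right: "Poly_Mapping.single (m + (n - ?e)) (c * (of_nat (Poly_Mapping.lookup n v) * d)) =
      Poly_Mapping.single ((m + n) - ?e) (c * (of_nat (Poly_Mapping.lookup n v) * d))"
  proof (cases "Poly_Mapping.lookup n v = 0")
    case False
    then show ?thesis by (simp only: shift add.commute[of m] not_False_eq_True)
  qed simp
  show ?thesis
    unfolding mult_single partial_single left right
    by (simp add: lookup_add algebra_simps flip: single_add)
qed

lemma phase_poly_induct [case_names zero add_single]:
  fixes f :: phase_poly
  assumes zero: "P 0" and add_single: "\<And>f m c. P f \<Longrightarrow> P (f + Poly_Mapping.single m c)"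
  shows "P f"
proof (induction f rule: update_induct)
  case const
  show ?case by (rule zero)
next
  case (update f m c)
  have "Poly_Mapping.update m c f = f + Poly_Mapping.single m c"
    using update.hyps by (intro poly_mapping_eqI)
      (auto simp: lookup_update lookup_add lookup_single when_def in_keys_iff)
  then show ?case using add_single[OF update.IH] by simp
qed

lemma partial_mult: "partial v (f * g) = partial v f * g + f * partial v g"
proof (induction f rule: phase_poly_induct)
  case zero
  show ?case by (simp add: partial_zero)
next
  case (add_single f m c)
  have "partial v (Poly_Mapping.single m c * g) =
      partial v (Poly_Mapping.single m c) * g + Poly_Mapping.single m c * partial v g"
    by (induction g rule: phase_poly_induct)
      (simp_all add: partial_zero partial_add distrib_left partial_single_mult_single)
  with add_single show ?case
    by (simp add: partial_add distrib_right)
qed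

lemma partial_power: "partial v (f ^ n) = of_nat n * f ^ (n - 1) * partial v f"
proof (induction n)
  case 0
  show ?case by (simp add: partial_single flip: single_one)
next
  case (Suc n)
  then show ?case by (cases n) (simp_all add: partial_mult algebra_simps)
qed

lemma partial_coef: "partial v (coef c) = 0"
  by (simp add: coef_def partial_single)

lemma partial_cnst: "partial v (cnst a) = 0"
  by (simp add: cnst_def partial_coef)

lemma partial_one: "partial v 1 = 0"
  using partial_coef[of v 1] by (simp add: coef_def)

lemma partial_numeral: "partial v (numeral n) = 0"
  using partial_coef[of v "numeral n"] by (simp add: coef_def)

lemma partial_var: "partial v (var u) = (if u = v then 1 else 0)"
  by (auto simp: var_def partial_single lookup_single)

lemmas partial_simps = partial_add partial_diff partial_uminus partial_mult partial_power
  partial_coef partial_cnst partial_one partial_numeral partial_var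

section \<open>Differentiation of the coefficients\<close>

lemma deriv_rat_fun_zero: "deriv_rat_fun 0 = 0"
  using deriv_rat_fun_Fract[of 1 0] by (simp add: Zero_fract_def)

lemma deriv_rat_fun_one: "deriv_rat_fun 1 = 0"
  using deriv_rat_fun_Fract[of 1 1] by (simp add: One_fract_def Zero_fract_def)

lemma deriv_rat_fun_indet_t: "deriv_rat_fun indet_t = 1"
  using deriv_rat_fun_Fract[of 1 "[:0, 1:]"]
  by (simp add: indet_t_def One_fract_def pderiv_pCons one_pCons)

lemma deriv_rat_fun_diff: "deriv_rat_fun (r - s) = deriv_rat_fun r - deriv_rat_fun s"
proof -
  obtain a b where r: "r = Fract a b" and b: "b \<noteq> 0" by (cases r)
  obtain c d where s: "s = Fract c d" and d: "d \<noteq> 0" by (cases s)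
  show ?thesis
    using b d unfolding r s
    by (simp add: deriv_rat_fun_Fract eq_fract pderiv_mult pderiv_diff) algebra
qed

text \<open>The map over coefficients acts on the support only; it agrees with pointwise
  differentiation because the derivative of 0 is 0.\<close>

lemma lookup_partial_t:
  "Poly_Mapping.lookup (partial_t f) m = deriv_rat_fun (Poly_Mapping.lookup f m)"
  by (simp add: partial_t_def Poly_Mapping.map.rep_eq when_def deriv_rat_fun_zero)

lemma partial_t_single:
  "partial_t (Poly_Mapping.single m c) = Poly_Mapping.single m (deriv_rat_fun c)"
  by (intro poly_mapping_eqI) (simp add: lookup_partial_t lookup_single when_def deriv_rat_fun_zero)

lemma partial_t_diff: "partial_t (f - g) = partial_t f - partial_t g"
  by (intro poly_mapping_eqI) (simp add: lookup_partial_t lookup_minus deriv_rat_fun_diff)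

lemma partial_t_zero: "partial_t 0 = 0"
  using partial_t_diff[of 0 0] by simp

lemma partial_t_add: "partial_t (f + g) = partial_t f + partial_t g"
  using partial_t_diff[of f "- g"] partial_t_diff[of 0 "g"] by (simp add: partial_t_diff partial_t_zero)

lemma partial_t_coef: "partial_t (coef c) = coef (deriv_rat_fun c)"
  by (simp add: coef_def partial_t_single)

lemma partial_t_one: "partial_t 1 = 0"
  using partial_t_coef[of 1] by (simp add: coef_def deriv_rat_fun_one)

lemma partial_t_var: "partial_t (var v) = 0"
  by (simp add: var_def partial_t_single deriv_rat_fun_one)

lemma partial_t_var_square: "partial_t (var v ^ 2) = 0"
  by (simp add: var_def power2_eq_square mult_single partial_t_single deriv_rat_fun_one)

section \<open>The parameters as ring elements\<close>

lemma coef_mult: "coef (a * b) = coef a * coef b"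
  by (simp add: coef_def mult_single)

lemma coef_add: "coef (a + b) = coef a + coef b"
  by (simp add: coef_def single_add)

lemma coef_diff: "coef (a - b) = coef a - coef b"
  by (simp add: coef_def single_diff)

lemma coef_one: "coef 1 = 1"
  by (simp add: coef_def)

lemma cnst_add: "cnst (a + b) = cnst a + cnst b"
  by (simp add: cnst_def flip: coef_add)

lemma cnst_mult: "cnst (a * b) = cnst a * cnst b"
  by (simp add: cnst_def mult.commute flip: coef_mult)

lemma cnst_zero: "cnst 0 = 0"
  by (simp add: cnst_def coef_def flip: Zero_fract_def)

lemma cnst_one: "cnst 1 = 1"
  by (simp add: cnst_def coef_one one_pCons[symmetric] flip: One_fract_def)

lemma cnst_numeral: "cnst (numeral n) = numeral n"
  by (induction n) (simp_all only: numeral.simps cnst_add cnst_one)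

lemma cnst_quarter: "4 * cnst (1 / 4) = 1"
proof -
  have "4 * cnst (1 / 4) = cnst (4 * (1 / 4))"
    by (simp only: cnst_mult cnst_numeral)
  then show ?thesis by (simp add: cnst_one)
qed

text \<open>The factor \<open>1/(t(t-1))\<close> of the Hamiltonian gets a name so that the polynomial
  computations treat it as one more constant.\<close>

definition prefactor :: phase_poly
  where "prefactor = coef (1 / (indet_t * (indet_t - 1)))"

lemma prefactor_mult:
  "prefactor * (coef indet_t * (coef indet_t - 1)) = 1"
proof -
  have "indet_t \<noteq> 0" "indet_t - 1 \<noteq> 0"
    by (simp_all add: indet_t_def One_fract_def Zero_fract_def eq_fract one_pCons)
  then have "1 / (indet_t * (indet_t - 1)) * (indet_t * (indet_t - 1)) = 1"
    by simp
  then show ?thesis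
    unfolding prefactor_def by (metis coef_mult coef_diff coef_one)
qed

lemma partial_prefactor: "partial v prefactor = 0"
  by (simp add: prefactor_def partial_coef)

section \<open>The divisibility behind the parabolic divisor\<close>

text \<open>With \<open>K = t(t-1)H\<close>, the right-hand side is \<open>-t(t-1) - \<partial>K/\<partial>x - 2w \<partial>K/\<partial>z\<close> at
  \<open>\<alpha>\<^sub>3 = 0\<close>. In the part free of \<open>x\<close> and \<open>z\<close>, setting \<open>w\<^sup>2 = t - y\<close> leaves \<open>y\<^sup>2\<close> with
  coefficient \<open>s - 2\<alpha>\<^sub>2 - \<alpha>\<^sub>4 = 0\<close>, while \<open>ty\<close> and \<open>t\<close> have coefficients that vanish by the
  normalisation of the parameters.\<close>

lemma y_plus_w2_minus_t_dvd:
  fixes x y z w t a0 a1 a2 a4 s :: "'a::comm_ring_1"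
  assumes norm: "a0 + a1 + 2 * a2 + a4 = 1" and s: "s = 2 * a2 + a4"
  shows "y + w ^ 2 - t dvd
    - (t * (t - 1))
    - (2 * x * y ^ 3 - (2 * (t + 1) * x + s) * y ^ 2
       + (2 * t * x + (a0 + s - (a0 + a1) * t)) * y + a1 * t + y * (y - 1) * z * w)
    - w * (- z * w ^ 4 + a4 * w ^ 3 + (2 * t - 1) * z * w ^ 2
       - (- a0 - s + (a4 + 1) * t) * w - t * (t - 1) * z + 2 * y * ((y - 1) * x - a2) * w)"
    (is "?F dvd ?D")
proof -
  let ?x = "- (2 * y ^ 3 - 2 * (t + 1) * y ^ 2 + 2 * t * y) - 2 * y * (y - 1) * w ^ 2"
  let ?zw = "w ^ 4 - (2 * t - 1) * w ^ 2 + t * (t - 1) - y * (y - 1)"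
  let ?r = "s * y ^ 2 - (a0 + s - (a0 + a1) * t) * y - a1 * t - t * (t - 1)
    - a4 * w ^ 4 + (- a0 - s + (a4 + 1) * t) * w ^ 2 + 2 * a2 * y * w ^ 2"
  \<comment> \<open>Collect the coefficients of \<open>x\<close>, of \<open>zw\<close> and the rest; each is a polynomial in \<open>y\<close> and
    \<open>w\<^sup>2\<close> that vanishes for \<open>w\<^sup>2 = t - y\<close>. The quotients come from factoring
    \<open>p(w\<^sup>2) - p(t - y)\<close>.\<close>
  have split: "?D = x * ?x + z * w * ?zw + ?r"
    by (simp add: algebra_simps eval_nat_numeral)
  have "?x = ?F * (- 2 * y * (y - 1))"
    by (simp add: algebra_simps eval_nat_numeral)
  then have x: "?F dvd ?x" by (rule dvdI)
  have "?zw = ?F * (w ^ 2 - y - t + 1)"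
    by (simp add: algebra_simps eval_nat_numeral)
  then have zw: "?F dvd ?zw" by (rule dvdI)
  have a0: "a0 = 1 - a1 - 2 * a2 - a4"
    using norm by (simp add: algebra_simps)
  have "?r = ?F * (a4 * (y - t - w ^ 2) - a0 - s + (a4 + 1) * t + 2 * a2 * y)"
    unfolding a0 s by (simp add: algebra_simps eval_nat_numeral)
  then have r: "?F dvd ?r" by (rule dvdI)
  show ?thesis
    unfolding split by (intro dvd_add dvd_mult x zw r)
qed

section \<open>The vector field\<close>

context
  fixes a0 a1 a2 a3 a4 :: complex
begin

private abbreviation (input) "x \<equiv> var X"
private abbreviation (input) "y \<equiv> var Y"
private abbreviation (input) "z \<equiv> var Z"
private abbreviation (input) "w \<equiv> var W"
private abbreviation (input) "t \<equiv> coef indet_t"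
private abbreviation (input) "c \<equiv> prefactor"
private abbreviation (input) "s \<equiv> 2 * cnst a2 + cnst a3 + cnst a4"

lemma partial_X_hamiltonian:
  "partial X (hamiltonian a0 a1 a2 a3 a4) =
    c * (2 * x * y ^ 3 - (2 * (t + 1) * x + s) * y ^ 2
      + (2 * t * x + (cnst a0 + s - (cnst a0 + cnst a1) * t)) * y
      + cnst a1 * t + y * (y - 1) * z * w)"
  unfolding hamiltonian_def Let_def prefactor_def[symmetric]
  by (simp add: partial_simps partial_prefactor algebra_simps eval_nat_numeral)

lemma partial_Y_hamiltonian:
  "partial Y (hamiltonian a0 a1 a2 a3 a4) =
    c * (3 * x ^ 2 * y ^ 2 - 2 * ((t + 1) * x + s) * x * y
      + t * x ^ 2 + (cnst a0 + s - (cnst a0 + cnst a1) * t) * x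
      + cnst a2 * (cnst a2 + cnst a3 + cnst a4) + ((2 * y - 1) * x - cnst a2) * z * w)"
  unfolding hamiltonian_def Let_def prefactor_def[symmetric]
  by (simp add: partial_simps partial_prefactor algebra_simps eval_nat_numeral)

text \<open>The flow derivative of \<open>w\<^sup>2\<close> contributes \<open>2w \<partial>H/\<partial>z\<close>. The factor 2 is absorbed here because
  it clears the fraction \<open>1/4\<close>.\<close>

lemma two_partial_Z_hamiltonian:
  "2 * partial Z (hamiltonian a0 a1 a2 a3 a4) =
    c * (- z * w ^ 4 + cnst a4 * w ^ 3 + (2 * t - 1) * z * w ^ 2
      - (- cnst a0 - s + (cnst a4 + 1) * t) * w - t * (t - 1) * z
      + 2 * y * ((y - 1) * x - cnst a2) * w)" (is "_ = c * (?M + ?N)")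
proof -
  have "2 * partial Z (hamiltonian a0 a1 a2 a3 a4) = c * (4 * cnst (1 / 4) * ?M + ?N)"
    unfolding hamiltonian_def Let_def prefactor_def[symmetric]
    by (simp add: partial_simps partial_prefactor algebra_simps eval_nat_numeral)
  then show ?thesis by (simp only: cnst_quarter mult_1)
qed

lemma partial_W_hamiltonian:
  "partial W (hamiltonian a0 a1 a2 a3 a4) =
    c * (cnst (1 / 4) * (- 4 * z ^ 2 * w ^ 3 + 6 * cnst a4 * z * w ^ 2
        + 2 * ((2 * t - 1) * z ^ 2 - cnst a4 ^ 2) * w
        - 2 * (- cnst a0 - s + (cnst a4 + 1) * t) * z)
      + y * ((y - 1) * x - cnst a2) * z)"
  unfolding hamiltonian_def Let_def prefactor_def[symmetric]
  by (simp add: partial_simps partial_prefactor algebra_simps eval_nat_numeral)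

lemma flow_derivative_var:
  "flow_derivative h x = partial Y h"
  "flow_derivative h y = - partial X h"
  "flow_derivative h z = partial W h"
  by (simp_all add: flow_derivative_def partial_simps partial_t_var)

lemma flow_derivative_y_minus_1:
  "flow_derivative h (y - 1) = - partial X h"
  by (simp add: flow_derivative_def partial_simps partial_t_diff partial_t_var partial_t_one)

text \<open>The summand \<open>- 1\<close> is the derivative of \<open>- t\<close>.\<close>

lemma flow_derivative_y_plus_w2_minus_t:
  "flow_derivative h (y + w ^ 2 - t) = - 1 - partial X h - w * (2 * partial Z h)"
  by (simp add: flow_derivative_def partial_simps partial_t_diff partial_t_add partial_t_var
      partial_t_var_square partial_t_coef deriv_rat_fun_indet_t coef_one)

section \<open>The invariant divisors\<close>

lemma invariant_divisor_y_minus_1: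
  assumes "a0 = 0"
  shows "invariant_divisor (hamiltonian a0 a1 a2 a3 a4) (y - 1)"
proof -
  have "flow_derivative (hamiltonian a0 a1 a2 a3 a4) (y - 1) =
      (y - 1) * - (c * (2 * x * y * (y - t) - s * y - cnst a1 * t + y * z * w))"
    unfolding flow_derivative_y_minus_1 partial_X_hamiltonian
    unfolding assms cnst_zero
    by (simp add: algebra_simps eval_nat_numeral)
  then show ?thesis
    unfolding invariant_divisor_def by (rule dvdI)
qed

lemma invariant_divisor_y:
  assumes "a1 = 0"
  shows "invariant_divisor (hamiltonian a0 a1 a2 a3 a4) y"
proof -
  have "flow_derivative (hamiltonian a0 a1 a2 a3 a4) y =
      y * - (c * (2 * x * (y - 1) * (y - t) - s * y + cnst a0 + s - cnst a0 * t + (y - 1) * z * w))"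
    unfolding flow_derivative_var partial_X_hamiltonian
    unfolding assms cnst_zero
    by (simp add: algebra_simps eval_nat_numeral)
  then show ?thesis
    unfolding invariant_divisor_def by (rule dvdI)
qed

lemma invariant_divisor_x:
  assumes "a2 = 0"
  shows "invariant_divisor (hamiltonian a0 a1 a2 a3 a4) x"
proof -
  have "flow_derivative (hamiltonian a0 a1 a2 a3 a4) x =
      x * (c * (3 * x * y ^ 2 - 2 * ((t + 1) * x + s) * y
      + t * x + (cnst a0 + s - (cnst a0 + cnst a1) * t) + (2 * y - 1) * z * w))"
    unfolding flow_derivative_var partial_Y_hamiltonian
    unfolding assms cnst_zero
    by (simp add: algebra_simps eval_nat_numeral)
  then show ?thesis
    unfolding invariant_divisor_def by (rule dvdI)
qed

lemma invariant_divisor_z: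
  assumes "a4 = 0"
  shows "invariant_divisor (hamiltonian a0 a1 a2 a3 a4) z"
proof -
  have "flow_derivative (hamiltonian a0 a1 a2 a3 a4) z =
      z * (c * (cnst (1 / 4) * (- 4 * z * w ^ 3 + 2 * ((2 * t - 1) * z) * w
        - 2 * (- cnst a0 - s + t))
      + y * ((y - 1) * x - cnst a2)))"
    unfolding flow_derivative_var partial_W_hamiltonian
    unfolding assms cnst_zero
    by (simp add: algebra_simps eval_nat_numeral)
  then show ?thesis
    unfolding invariant_divisor_def by (rule dvdI)
qed

lemma invariant_divisor_y_plus_w2_minus_t:
  assumes "a0 + a1 + 2 * a2 + 2 * a3 + a4 = 1" and "a3 = 0"
  shows "invariant_divisor (hamiltonian a0 a1 a2 a3 a4) (y + w ^ 2 - t)"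
proof -
  have norm: "cnst a0 + cnst a1 + 2 * cnst a2 + cnst a4 = 1"
    using arg_cong[OF assms(1), of cnst]
    by (simp add: assms(2) cnst_add cnst_mult cnst_numeral cnst_one)
  have s: "s = 2 * cnst a2 + cnst a4"
    by (simp add: assms(2) cnst_zero)
  have factor: "- (c * A) - c * B - w * (c * C) = c * (- A - B - w * C)" for A B C
    by (simp add: algebra_simps)
  have flow: "flow_derivative (hamiltonian a0 a1 a2 a3 a4) (y + w ^ 2 - t) =
      - (c * (t * (t - 1))) - partial X (hamiltonian a0 a1 a2 a3 a4)
        - w * (2 * partial Z (hamiltonian a0 a1 a2 a3 a4))"
    by (simp only: flow_derivative_y_plus_w2_minus_t prefactor_mult)
  show ?thesis
    unfolding invariant_divisor_def flow two_partial_Z_hamiltonian partial_X_hamiltonian factor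
    by (rule dvd_mult, rule y_plus_w2_minus_t_dvd[OF norm s])
qed

end

theorem proposition2p2:
  fixes \<alpha>0 \<alpha>1 \<alpha>2 \<alpha>3 \<alpha>4 :: complex
  assumes "\<alpha>0 + \<alpha>1 + 2 * \<alpha>2 + 2 * \<alpha>3 + \<alpha>4 = 1"
  defines "H \<equiv> hamiltonian \<alpha>0 \<alpha>1 \<alpha>2 \<alpha>3 \<alpha>4"
  shows "(\<alpha>0 = 0 \<longrightarrow> invariant_divisor H (var Y - 1)) \<and>
         (\<alpha>1 = 0 \<longrightarrow> invariant_divisor H (var Y)) \<and>
         (\<alpha>2 = 0 \<longrightarrow> invariant_divisor H (var X)) \<and>
         (\<alpha>3 = 0 \<longrightarrow> invariant_divisor H (var Y + (var W)^2 - coef indet_t)) \<and>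
         (\<alpha>4 = 0 \<longrightarrow> invariant_divisor H (var Z))"
  unfolding H_def
  by (intro conjI impI invariant_divisor_y_minus_1 invariant_divisor_y invariant_divisor_x
      invariant_divisor_y_plus_w2_minus_t[OF assms(1)] invariant_divisor_z)

end
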